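(* Let $a$ be a positive odd integer, let $k,m$ be nonnegative integers and let $n$ be a positive integer. If $n\equiv \frac{a-1}2\pmod 2$, then $$t(a,3a,16k+4,16m+4;n)=\frac 23N(a,3a,16k+4,16m+4;8n+16k+16m+4a+8)-2N(a,3a,16k+4,16m+4;2n+4k+4m+a+2).$$
   Context: For positive integers $a,b,c,d$ and a nonnegative integer $n$, $N(a,b,c,d;n)$ denotes the number of $(x,y,z,w)\in\mathbb Z^4$ with $n=ax^2+by^2+cz^2+dw^2$, and $t(a,b,c,d;n)$ denotes the number of $(x,y,z,w)\in\mathbb Z^4$ with $n=a\frac{x(x-1)}2+b\frac{y(y-1)}2+c\frac{z(z-1)}2+d\frac{w(w-1)}2$. *)

theory Defs
  imports Complex_Main "HOL-Number_Theory.Cong"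
begin

text \<open>
  Both counts are meant for positive coefficients only: then the sets are finite and
  \<^const>\<open>card\<close> is the number of representations.
  In \<open>t_rep\<close> the integer division is exact, since \<open>x * (x - 1)\<close> is even.
\<close>

definition N_rep :: "nat \<Rightarrow> nat \<Rightarrow> nat \<Rightarrow> nat \<Rightarrow> nat \<Rightarrow> nat" where
  "N_rep a b c d n = card {(x :: int, y :: int, z :: int, w :: int).
     int n = int a * x\<^sup>2 + int b * y\<^sup>2 + int c * z\<^sup>2 + int d * w\<^sup>2}"

definition t_rep :: "nat \<Rightarrow> nat \<Rightarrow> nat \<Rightarrow> nat \<Rightarrow> nat \<Rightarrow> nat" where
  "t_rep a b c d n = card {(x :: int, y :: int, z :: int, w :: int).
     int n = int a * (x * (x - 1) div 2) + int b * (y * (y - 1) div 2)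
           + int c * (z * (z - 1) div 2) + int d * (w * (w - 1) div 2)}"

end

theory Submission
  imports Defs
begin

text \<open>
  Put \<open>M = 8 n + 16 k + 16 m + 4 a + 8\<close>.  Completing squares, \<open>t(n)\<close> counts the representations
  of \<open>M\<close> with all four variables odd.  Modulo 16, every representation of \<open>M\<close> has \<open>x \<equiv> y\<close> and
  \<open>z \<equiv> w\<close> modulo 2, and if \<open>x = 2 u\<close> and \<open>y = 2 v\<close> are even, then \<open>u + v\<close> is odd.  For fixed
  \<open>z, w\<close>, the identity \<open>(u + 3 v)\<^sup>2 + 3 (u - v)\<^sup>2 = 4 (u\<^sup>2 + 3 v\<^sup>2)\<close> shows that there are exactly
  twice as many representations with \<open>x, y\<close> odd as with \<open>x, y\<close> even.  Finally, the representations
  with all variables even are those of \<open>M / 4\<close>, so \<open>N(M) = 3 (t(n) / 2 + N(M / 4))\<close>.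
\<close>

lemma even_square_int:
  fixes x :: int
  assumes "even x"
  obtains p where "x\<^sup>2 = 4 * p"
proof -
  from assms obtain i where "x = 2 * i" by (elim evenE)
  then have "x\<^sup>2 = 4 * i\<^sup>2" by (simp add: power2_eq_square)
  then show thesis by (rule that)
qed

lemma odd_square_int:
  fixes x :: int
  assumes "odd x"
  obtains p where "x\<^sup>2 = 8 * p + 1"
proof -
  from assms obtain i where i: "x = 2 * i + 1" by (elim oddE)
  have "even (i * (i + 1))" by simp
  then obtain p where "i * (i + 1) = 2 * p" by (elim evenE)
  with i have "x\<^sup>2 = 8 * p + 1" by (simp add: power2_eq_square algebra_simps)
  then show thesis by (rule that)
qed

text \<open>For odd \<open>x\<close>, \<open>y\<close>, exactly one of \<open>x - y\<close>,
  \<open>x + y\<close> is a multiple of 4, and negating \<open>y\<close> exchanges the two cases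
  without changing \<open>x\<^sup>2 + 3 * y\<^sup>2\<close>; this is the factor 2. The half with
  \<open>4 dvd x - y\<close> is parametrised by \<open>(u + 3 * v, u - v)\<close>, whose entries are
  odd exactly when \<open>u + v\<close> is. The parameter \<open>q\<close> carries the variables
  that stay fixed.\<close>

lemma card_odd_pairs:
  fixes P :: "int \<Rightarrow> 'q \<Rightarrow> bool"
  assumes fin: "finite {(x :: int, y, q). odd x \<and> odd y \<and> P (x\<^sup>2 + 3 * y\<^sup>2) q}"
  shows "card {(x :: int, y, q). odd x \<and> odd y \<and> P (x\<^sup>2 + 3 * y\<^sup>2) q}
    = 2 * card {(u :: int, v, q). odd (u + v) \<and> P (4 * (u\<^sup>2 + 3 * v\<^sup>2)) q}"
    (is "card ?X = 2 * card ?F")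
proof -
  define X1 where "X1 = {(x, y, q). (x, y, q) \<in> ?X \<and> 4 dvd x - y}"
  define X2 where "X2 = {(x, y, q). (x, y, q) \<in> ?X \<and> 4 dvd x + y}"
  \<comment> \<open>The sum and the difference are even and differ by \<open>2 * y\<close>, which is
    2 modulo 4.\<close>
  have sign: "4 dvd x + y \<longleftrightarrow> \<not> 4 dvd x - y" if "odd x" "odd y" for x y :: int
    using that by presburger
  have X: "?X = X1 \<union> X2"
    unfolding X1_def X2_def using sign by blast
  have disj: "X1 \<inter> X2 = {}"
    unfolding X1_def X2_def using sign by blast
  have norm: "(u + 3 * v)\<^sup>2 + 3 * (u - v)\<^sup>2 = 4 * (u\<^sup>2 + 3 * v\<^sup>2)" for u v :: int
    by (simp add: power2_eq_square algebra_simps)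
  have bij1: "bij_betw (\<lambda>(u, v, q). (u + 3 * v, u - v, q)) ?F X1"
  \<comment> \<open>Solving \<open>x = u + 3 * v\<close>, \<open>y = u - v\<close> gives
    \<open>v = (x - y) / 4\<close> and \<open>u = y + v\<close>. Then
    \<open>u + v = y + 2 * v\<close> has the parity of \<open>y\<close>.\<close>
  proof (rule bij_betw_byWitness[where f' = "\<lambda>(x, y, q). (y + (x - y) div 4, (x - y) div 4, q)"])
    show "(\<lambda>(u, v, q). (u + 3 * v, u - v, q)) ` ?F \<subseteq> X1"
      unfolding X1_def by (auto simp: norm)
    have "odd (y + 2 * v) \<and> P (4 * ((y + v)\<^sup>2 + 3 * v\<^sup>2)) q"
      if "odd y" "P (x\<^sup>2 + 3 * y\<^sup>2) q" "x - y = 4 * v" for x y v q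
    proof -
      from that have "x = (y + v) + 3 * v" by simp
      with that norm[of "y + v" v] show ?thesis by simp
    qed
    then have "odd (y + 2 * ((x - y) div 4)) \<and>
        P (4 * ((y + (x - y) div 4)\<^sup>2 + 3 * ((x - y) div 4)\<^sup>2)) q"
      if "(x, y, q) \<in> X1" for x y q
      using that by (auto simp: X1_def simp del: even_add)
    then show "(\<lambda>(x, y, q). (y + (x - y) div 4, (x - y) div 4, q)) ` X1 \<subseteq> ?F"
      by auto
  qed (auto simp: X1_def)
  have bij2: "bij_betw (\<lambda>(x, y, q). (x, - y, q)) X1 X2"
    by (rule bij_betw_byWitness[where f' = "\<lambda>(x, y, q). (x, - y, q)"])
      (auto simp: X1_def X2_def)
  have "finite X1" "finite X2"
    using fin unfolding X by auto
  then have "card ?X = card X1 + card X2"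
    unfolding X using disj by (rule card_Un_disjoint)
  with bij_betw_same_card[OF bij1] bij_betw_same_card[OF bij2] show ?thesis
    by simp
qed

text \<open>A crude box suffices for finiteness:
  \<open>\<bar>x\<bar> \<le> x\<^sup>2 \<le> c * x\<^sup>2 \<le> M\<close>, with \<open>r\<close>
  standing for the other three terms of a form.\<close>

lemma abs_le_of_pos_mult_square:
  fixes c x M r :: int
  assumes "c > 0" "M = c * x\<^sup>2 + r" "r \<ge> 0"
  shows "x \<in> {- M..M}"
proof -
  have "\<bar>x\<bar> * 1 \<le> \<bar>x\<bar> * \<bar>x\<bar>"
    by (cases "x = 0") (simp, intro mult_left_mono, auto)
  also have "\<dots> = x\<^sup>2" by (simp add: power2_eq_square)
  also have "\<dots> \<le> c * x\<^sup>2"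
    using assms(1) by (simp add: mult_le_cancel_right1)
  finally show ?thesis using assms by auto
qed

lemma finite_diagonal_representations:
  fixes a b c d M :: int
  assumes "a > 0" "b > 0" "c > 0" "d > 0"
  shows "finite {(x, y, z, w). M = a * x\<^sup>2 + b * y\<^sup>2 + c * z\<^sup>2 + d * w\<^sup>2}"
proof (rule finite_subset)
  show "{(x, y, z, w). M = a * x\<^sup>2 + b * y\<^sup>2 + c * z\<^sup>2 + d * w\<^sup>2}
    \<subseteq> {- M..M} \<times> {- M..M} \<times> {- M..M} \<times> {- M..M}"
  proof
    fix p
    assume "p \<in> {(x, y, z, w). M = a * x\<^sup>2 + b * y\<^sup>2 + c * z\<^sup>2 + d * w\<^sup>2}"
    then obtain x y z w where p: "p = (x, y, z, w)"
      and M: "M = a * x\<^sup>2 + b * y\<^sup>2 + c * z\<^sup>2 + d * w\<^sup>2" by blast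
    have nonneg: "a * x\<^sup>2 \<ge> 0" "b * y\<^sup>2 \<ge> 0" "c * z\<^sup>2 \<ge> 0" "d * w\<^sup>2 \<ge> 0"
      using assms by auto
    have "x \<in> {- M..M}"
      by (rule abs_le_of_pos_mult_square[of a M x "b * y\<^sup>2 + c * z\<^sup>2 + d * w\<^sup>2"])
        (use assms M nonneg in auto)
    moreover have "y \<in> {- M..M}"
      by (rule abs_le_of_pos_mult_square[of b M y "a * x\<^sup>2 + c * z\<^sup>2 + d * w\<^sup>2"])
        (use assms M nonneg in auto)
    moreover have "z \<in> {- M..M}"
      by (rule abs_le_of_pos_mult_square[of c M z "a * x\<^sup>2 + b * y\<^sup>2 + d * w\<^sup>2"])
        (use assms M nonneg in auto)
    moreover have "w \<in> {- M..M}"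
      by (rule abs_le_of_pos_mult_square[of d M w "a * x\<^sup>2 + b * y\<^sup>2 + c * z\<^sup>2"])
        (use assms M nonneg in auto)
    ultimately show "p \<in> {- M..M} \<times> {- M..M} \<times> {- M..M} \<times> {- M..M}"
      unfolding p by blast
  qed
qed simp

text \<open>Multiplying the equation by 8 and adding \<open>a + b + c + d\<close> completes every
  square, since 8 times a triangular number plus 1 is \<open>(2 * x - 1)\<^sup>2\<close>. The map
  \<open>x\<close> to \<open>2 * x - 1\<close> is a bijection from the integers to the odd
  integers.\<close>

lemma t_rep_eq_card_odd:
  "t_rep a b c d n = card {(x :: int, y :: int, z :: int, w :: int).
     odd x \<and> odd y \<and> odd z \<and> odd w \<and>
     int (8 * n + a + b + c + d) = int a * x\<^sup>2 + int b * y\<^sup>2 + int c * z\<^sup>2 + int d * w\<^sup>2}"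
proof -
  have tri: "(2 * x - 1)\<^sup>2 = 8 * (x * (x - 1) div 2) + 1" for x :: int
  proof -
    have "x * (x - 1) = 2 * (x * (x - 1) div 2)" by simp
    moreover have "(2 * x - 1)\<^sup>2 = 4 * (x * (x - 1)) + 1"
      by (simp add: power2_eq_square algebra_simps)
    ultimately show ?thesis by linarith
  qed
  define S where "S = {(x :: int, y :: int, z :: int, w :: int).
     int n = int a * (x * (x - 1) div 2) + int b * (y * (y - 1) div 2)
           + int c * (z * (z - 1) div 2) + int d * (w * (w - 1) div 2)}"
  define T where "T = {(x :: int, y :: int, z :: int, w :: int).
     odd x \<and> odd y \<and> odd z \<and> odd w \<and>
     int (8 * n + a + b + c + d) = int a * x\<^sup>2 + int b * y\<^sup>2 + int c * z\<^sup>2 + int d * w\<^sup>2}"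
  have key: "(2 * x - 1, 2 * y - 1, 2 * z - 1, 2 * w - 1) \<in> T \<longleftrightarrow> (x, y, z, w) \<in> S"
    for x y z w
    unfolding S_def T_def by (simp add: tri distrib_left) linarith
  have "bij_betw (\<lambda>(x, y, z, w). (2 * x - 1, 2 * y - 1, 2 * z - 1, 2 * w - 1)) S T"
    unfolding bij_betw_def
  proof
    show "(\<lambda>(x, y, z, w). (2 * x - 1, 2 * y - 1, 2 * z - 1, 2 * w - 1)) ` S = T"
    proof (intro equalityI subsetI)
      fix p assume p: "p \<in> T"
      obtain x y z w where xyzw: "p = (x, y, z, w)" by (metis surj_pair)
      with p have "odd x" "odd y" "odd z" "odd w" by (auto simp: T_def)
      moreover have "i = 2 * ((i + 1) div 2) - 1" if "odd i" for i :: int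
        using that by presburger
      ultimately have "p = (2 * ((x + 1) div 2) - 1, 2 * ((y + 1) div 2) - 1,
          2 * ((z + 1) div 2) - 1, 2 * ((w + 1) div 2) - 1)"
        unfolding xyzw by blast
      with p key show "p \<in> (\<lambda>(x, y, z, w). (2 * x - 1, 2 * y - 1, 2 * z - 1, 2 * w - 1)) ` S"
        by (metis (no_types, lifting) image_eqI case_prod_conv)
    qed (use key in auto)
  qed (auto simp: inj_on_def)
  then show ?thesis
    unfolding t_rep_def S_def[symmetric] T_def[symmetric] by (rule bij_betw_same_card)
qed

text \<open>The equation is the original one divided by 4, with \<open>x = 2 * u\<close> and
  \<open>y = 2 * v\<close>. If \<open>u + v\<close> were even, then 4 would divide
  \<open>u\<^sup>2 + 3 * v\<^sup>2\<close>, leaving \<open>M\<close> congruent to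
  \<open>z\<^sup>2 + w\<^sup>2\<close> modulo 4; a sum of two squares is never 3 modulo 4.\<close>

lemma even_pair_parities:
  fixes a k m u v z w M :: int
  assumes "odd a" "M mod 4 = 3"
    and eq: "M = a * (u\<^sup>2 + 3 * v\<^sup>2) + (4 * k + 1) * z\<^sup>2 + (4 * m + 1) * w\<^sup>2"
  shows "odd (u + v) \<and> (even z \<longleftrightarrow> even w)"
proof -
  have "odd M" using assms(2) by presburger
  have "odd (u + v)"
  proof
    assume "even (u + v)"
    have "4 dvd u\<^sup>2 + 3 * v\<^sup>2"
    proof (cases "even u")
      case True
      with \<open>even (u + v)\<close> have "even v" by simp
      obtain p where "u\<^sup>2 = 4 * p" using True by (rule even_square_int)
      moreover obtain q where "v\<^sup>2 = 4 * q" using \<open>even v\<close> by (rule even_square_int)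
      ultimately show ?thesis by simp
    next
      case False
      with \<open>even (u + v)\<close> have "odd v" by simp
      obtain p where "u\<^sup>2 = 8 * p + 1" using False by (rule odd_square_int)
      moreover obtain q where "v\<^sup>2 = 8 * q + 1" using \<open>odd v\<close> by (rule odd_square_int)
      ultimately show ?thesis by presburger
    qed
    then obtain s where s: "u\<^sup>2 + 3 * v\<^sup>2 = 4 * s" by (elim dvdE)
    have "M = 4 * (a * s + k * z\<^sup>2 + m * w\<^sup>2) + (z\<^sup>2 + w\<^sup>2)"
      unfolding eq s by (simp add: algebra_simps)
    with assms(2) have "(z\<^sup>2 + w\<^sup>2) mod 4 = 3" by presburger
    moreover have "x\<^sup>2 mod 4 = 0 \<or> x\<^sup>2 mod 4 = 1" for x :: int
    proof (cases "even x")
      case True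
      then obtain p where "x\<^sup>2 = 4 * p" by (rule even_square_int)
      then show ?thesis by simp
    next
      case False
      then obtain p where "x\<^sup>2 = 8 * p + 1" by (rule odd_square_int)
      then show ?thesis by presburger
    qed
    from this[of z] this[of w] have "(z\<^sup>2 + w\<^sup>2) mod 4 \<noteq> 3" by presburger
    ultimately show False by simp
  qed
  \<comment> \<open>Now \<open>a * (u\<^sup>2 + 3 * v\<^sup>2)\<close> is odd, as is
    \<open>M\<close>, so \<open>z\<^sup>2 + w\<^sup>2\<close> must be even.\<close>
  moreover from this \<open>odd M\<close> \<open>odd a\<close> have "even z \<longleftrightarrow> even w"
    unfolding eq by auto
  ultimately show ?thesis ..
qed

text \<open>For odd \<open>x\<close>, \<open>y\<close>, the value
  \<open>x\<^sup>2 + 3 * y\<^sup>2\<close> is 4 times an odd number. Dividing the equation by 4 and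
  reducing modulo 2 therefore makes \<open>z\<^sup>2 + w\<^sup>2\<close> even.\<close>

lemma odd_pair_parities:
  fixes a k m x y z w M :: int
  assumes "odd a" "odd M" "odd x" "odd y"
    and eq: "4 * M = a * (x\<^sup>2 + 3 * y\<^sup>2) + (16 * k + 4) * z\<^sup>2 + (16 * m + 4) * w\<^sup>2"
  shows "even z \<longleftrightarrow> even w"
proof -
  obtain p where p: "x\<^sup>2 = 8 * p + 1" using \<open>odd x\<close> by (rule odd_square_int)
  obtain q where q: "y\<^sup>2 = 8 * q + 1" using \<open>odd y\<close> by (rule odd_square_int)
  have "4 * M = 4 * (a * (2 * p + 6 * q + 1) + (4 * k + 1) * z\<^sup>2 + (4 * m + 1) * w\<^sup>2)"
    unfolding eq p q by (simp add: algebra_simps)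
  then have "M = a * (2 * p + 6 * q + 1) + (4 * k + 1) * z\<^sup>2 + (4 * m + 1) * w\<^sup>2"
    by simp
  with \<open>odd M\<close> have "odd (a * (2 * p + 6 * q + 1) + (4 * k + 1) * z\<^sup>2 + (4 * m + 1) * w\<^sup>2)"
    by simp
  with \<open>odd a\<close> show ?thesis by auto
qed

lemma card_representations_four_mult:
  fixes a k m M :: int
  assumes "a > 0" "odd a" "k \<ge> 0" "m \<ge> 0" "M mod 4 = 3"
  defines "R \<equiv> \<lambda>L. {(x, y, z, w). L = a * x\<^sup>2 + 3 * a * y\<^sup>2 + (16 * k + 4) * z\<^sup>2 + (16 * m + 4) * w\<^sup>2}"
  shows "2 * card (R (4 * M))
    = 3 * card {(x, y, z, w). odd x \<and> odd y \<and> odd z \<and> odd w \<and> (x, y, z, w) \<in> R (4 * M)}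
      + 6 * card (R M)"
proof -
  have "odd M" using assms(5) by presburger
  have fin: "finite (R (4 * M))"
    unfolding R_def by (rule finite_diagonal_representations) (use assms in auto)
  \<comment> \<open>\<open>P\<close> sees \<open>x\<close>, \<open>y\<close> only through
    \<open>s\<close>, the value of \<open>x\<^sup>2 + 3 * y\<^sup>2\<close>, as
    \<open>card_odd_pairs\<close> requires; \<open>e\<close> records whether \<open>z\<close> and
    \<open>w\<close> are both even or both odd.\<close>
  define P where "P e s q \<longleftrightarrow> (case q of (z, w) \<Rightarrow> even z = e \<and> even w = e \<and>
      4 * M = a * s + (16 * k + 4) * z\<^sup>2 + (16 * m + 4) * w\<^sup>2)" for e and s :: int and q
  define X where "X e = {(x :: int, y, q). odd x \<and> odd y \<and> P e (x\<^sup>2 + 3 * y\<^sup>2) q}" for e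
  define Y where "Y e = {(x :: int, y, q). even x \<and> even y \<and> P e (x\<^sup>2 + 3 * y\<^sup>2) q}" for e
  define F where "F e = {(u :: int, v, q). odd (u + v) \<and> P e (4 * (u\<^sup>2 + 3 * v\<^sup>2)) q}" for e

  have R_alt: "(x, y, z, w) \<in> R (4 * M) \<longleftrightarrow>
      4 * M = a * (x\<^sup>2 + 3 * y\<^sup>2) + (16 * k + 4) * z\<^sup>2 + (16 * m + 4) * w\<^sup>2" for x y z w
    by (simp add: R_def distrib_left mult.assoc mult.left_commute)
  have P_R: "P e (x\<^sup>2 + 3 * y\<^sup>2) (z, w) \<longleftrightarrow> even z = e \<and> even w = e \<and> (x, y, z, w) \<in> R (4 * M)"
    for e x y z w
    by (simp only: P_def R_alt prod.case)
  have XR: "X e \<subseteq> R (4 * M)" and YR: "Y e \<subseteq> R (4 * M)" for e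
    unfolding X_def Y_def by (auto simp: P_R)
  have finX: "finite (X e)" and finY: "finite (Y e)" for e
    by (rule finite_subset[OF XR fin], rule finite_subset[OF YR fin])

  have X_F: "card (X e) = 2 * card (F e)" for e
    unfolding X_def F_def by (rule card_odd_pairs) (rule finX[unfolded X_def])

  have quarter: "M = a * (u\<^sup>2 + 3 * v\<^sup>2) + (4 * k + 1) * z\<^sup>2 + (4 * m + 1) * w\<^sup>2"
    if "4 * M = a * (4 * (u\<^sup>2 + 3 * v\<^sup>2)) + (16 * k + 4) * z\<^sup>2 + (16 * m + 4) * w\<^sup>2" for u v z w
  proof -
    have "4 * M = 4 * (a * (u\<^sup>2 + 3 * v\<^sup>2) + (4 * k + 1) * z\<^sup>2 + (4 * m + 1) * w\<^sup>2)"
      unfolding that by (simp add: algebra_simps)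
    then show ?thesis by simp
  qed
  \<comment> \<open>Because \<open>M\<close> is 3 modulo 4, the condition \<open>odd (u + v)\<close>
    in \<open>F\<close> holds automatically, so halving even \<open>x\<close>, \<open>y\<close>
    always lands in \<open>F\<close>.\<close>
  have P_par: "odd (u + v)" if "P e (4 * (u\<^sup>2 + 3 * v\<^sup>2)) q" for e u v q
    using even_pair_parities[OF \<open>odd a\<close> assms(5) quarter] that
    unfolding P_def by (auto split: prod.splits)
  have double: "(2 * u)\<^sup>2 + 3 * (2 * v)\<^sup>2 = 4 * (u\<^sup>2 + 3 * v\<^sup>2)" for u v :: int
    by (simp add: power2_eq_square)

  have Y_F: "card (F e) = card (Y e)" for e
  proof (rule bij_betw_same_card)
    show "bij_betw (\<lambda>(u, v, q). (2 * u, 2 * v, q)) (F e) (Y e)"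
    proof (rule bij_betw_byWitness[where f' = "\<lambda>(x, y, q). (x div 2, y div 2, q)"])
      show "(\<lambda>(u, v, q). (2 * u, 2 * v, q)) ` F e \<subseteq> Y e"
        unfolding F_def Y_def by (auto simp only: double) auto
      show "(\<lambda>(x, y, q). (x div 2, y div 2, q)) ` Y e \<subseteq> F e"
      proof clarify
        fix x y z w assume "(x, y, z, w) \<in> Y e"
        then have "even x" "even y" and P: "P e (x\<^sup>2 + 3 * y\<^sup>2) (z, w)"
          by (auto simp: Y_def)
        then obtain u v where uv: "x = 2 * u" "y = 2 * v" by (elim evenE)
        from P have "P e (4 * (u\<^sup>2 + 3 * v\<^sup>2)) (z, w)" unfolding uv double .
        with P_par uv show "(x div 2, y div 2, z, w) \<in> F e"
          by (simp add: F_def)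
      qed
    qed (auto simp: F_def Y_def)
  qed

  \<comment> \<open>When \<open>z\<close> and \<open>w\<close> are even as well, the whole equation
    can be divided by 4, which turns \<open>4 * M\<close> into \<open>M\<close> with the same
    coefficients.\<close>
  have "card (R M) = card (F True)"
  proof (rule bij_betw_same_card)
    have scale: "P True (4 * (u\<^sup>2 + 3 * v\<^sup>2)) (2 * z, 2 * w) \<longleftrightarrow> (u, v, z, w) \<in> R M" for u v z w
    proof -
      have eq: "a * (4 * (u\<^sup>2 + 3 * v\<^sup>2)) + (16 * k + 4) * (2 * z)\<^sup>2 + (16 * m + 4) * (2 * w)\<^sup>2
        = 4 * (a * u\<^sup>2 + 3 * a * v\<^sup>2 + (16 * k + 4) * z\<^sup>2 + (16 * m + 4) * w\<^sup>2)"
        by (simp add: power2_eq_square algebra_simps)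
      show ?thesis unfolding P_def R_def prod.case eq by (simp del: distrib_left_numeral)
    qed
    show "bij_betw (\<lambda>(u, v, z, w). (u, v, 2 * z, 2 * w)) (R M) (F True)"
    proof (rule bij_betw_byWitness[where f' = "\<lambda>(u, v, z, w). (u, v, z div 2, w div 2)"])
      show "(\<lambda>(u, v, z, w). (u, v, 2 * z, 2 * w)) ` R M \<subseteq> F True"
      proof clarify
        fix u v z w assume "(u, v, z, w) \<in> R M"
        then have "P True (4 * (u\<^sup>2 + 3 * v\<^sup>2)) (2 * z, 2 * w)" by (simp only: scale)
        with P_par show "(u, v, 2 * z, 2 * w) \<in> F True" by (simp add: F_def)
      qed
      show "(\<lambda>(u, v, z, w). (u, v, z div 2, w div 2)) ` F True \<subseteq> R M"
      proof clarify
        fix u v z w assume "(u, v, z, w) \<in> F True"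
        then have P: "P True (4 * (u\<^sup>2 + 3 * v\<^sup>2)) (z, w)" by (simp add: F_def)
        then have "even z" "even w" by (auto simp: P_def)
        then have "(z, w) = (2 * (z div 2), 2 * (w div 2))" by simp
        with P show "(u, v, z div 2, w div 2) \<in> R M" by (metis scale)
      qed
    qed (auto simp: F_def P_def)
  qed

  moreover have "{(x, y, z, w). odd x \<and> odd y \<and> odd z \<and> odd w \<and> (x, y, z, w) \<in> R (4 * M)} = X False"
    unfolding X_def by (auto simp: P_R)

  moreover have "R (4 * M) = (X False \<union> X True) \<union> (Y False \<union> Y True)"
  proof
    show "R (4 * M) \<subseteq> (X False \<union> X True) \<union> (Y False \<union> Y True)"
    proof clarify
      fix x y z w
      assume R: "(x, y, z, w) \<in> R (4 * M)" and notY: "(x, y, z, w) \<notin> Y True" "(x, y, z, w) \<notin> Y False"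
        and notX: "(x, y, z, w) \<notin> X True"
      then have eq: "4 * M = a * (x\<^sup>2 + 3 * y\<^sup>2) + (16 * k + 4) * z\<^sup>2 + (16 * m + 4) * w\<^sup>2"
        by (simp only: R_alt)
      then have "even (a * (x\<^sup>2 + 3 * y\<^sup>2) + (16 * k + 4) * z\<^sup>2 + (16 * m + 4) * w\<^sup>2)"
        by (metis dvd_mult2 even_numeral)
      with \<open>odd a\<close> have xy: "even x \<longleftrightarrow> even y" by auto
      \<comment> \<open>Modulo 2 the equation for \<open>4 * M\<close> says nothing about
        \<open>z\<close> and \<open>w\<close>, whose coefficients are even; their parities are
        compared only after division by 4, separately for even and odd \<open>x\<close>,
        \<open>y\<close>.\<close>
      have zw: "even z \<longleftrightarrow> even w"
      proof (cases "even x")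
        case True
        with xy obtain u v where uv: "x = 2 * u" "y = 2 * v" by (auto elim!: evenE)
        from eq have "4 * M = a * (4 * (u\<^sup>2 + 3 * v\<^sup>2)) + (16 * k + 4) * z\<^sup>2 + (16 * m + 4) * w\<^sup>2"
          unfolding uv double .
        from even_pair_parities[OF \<open>odd a\<close> assms(5) quarter[OF this]] show ?thesis by simp
      next
        case False
        with xy have "odd y" by simp
        from odd_pair_parities[OF \<open>odd a\<close> \<open>odd M\<close> False this eq] show ?thesis .
      qed
      from xy zw R notX notY show "(x, y, z, w) \<in> X False"
        by (auto simp: X_def Y_def P_R)
    qed
  qed (use XR YR in auto)
  moreover have "card ((X False \<union> X True) \<union> (Y False \<union> Y True))
    = (card (X False) + card (X True)) + (card (Y False) + card (Y True))"
  proof -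
    have "(X False \<union> X True) \<inter> (Y False \<union> Y True) = {}" by (auto simp: X_def Y_def)
    moreover have "X False \<inter> X True = {}" "Y False \<inter> Y True = {}"
      by (auto simp: X_def Y_def P_R)
    ultimately show ?thesis by (simp add: card_Un_disjoint finX finY)
  qed
  \<comment> \<open>The four classes add up to \<open>3 * (card (F False) + card (F True))\<close>,
    where \<open>card (F False)\<close> is half of \<open>card (X False)\<close> and
    \<open>card (F True)\<close> is \<open>card (R M)\<close>.\<close>
  ultimately show ?thesis
    using X_F Y_F by simp
qed

theorem theorem2p4:
  fixes a k m n :: nat
  assumes "a > 0" and "odd a"
    and "n > 0"
    and "[n = (a - 1) div 2] (mod 2)"
  shows "real (t_rep a (3 * a) (16 * k + 4) (16 * m + 4) n) =
      2 / 3 * real (N_rep a (3 * a) (16 * k + 4) (16 * m + 4) (8 * n + 16 * k + 16 * m + 4 * a + 8))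
      - 2 * real (N_rep a (3 * a) (16 * k + 4) (16 * m + 4) (2 * n + 4 * k + 4 * m + a + 2))"
proof -
  let ?M = "2 * n + 4 * k + 4 * m + a + 2"
  let ?N = "N_rep a (3 * a) (16 * k + 4) (16 * m + 4)"
  have "n mod 2 = (a - 1) div 2 mod 2"
    using assms(4) by (simp add: cong_def)
  \<comment> \<open>The congruence gives \<open>2 * n\<close> congruent to \<open>a - 1\<close>
    modulo 4, so \<open>?M\<close> is congruent to \<open>2 * a + 1\<close>, which is 3 for odd
    \<open>a\<close>.\<close>
  with \<open>odd a\<close> have "?M mod 4 = 3" by presburger
  then have "int ?M mod 4 = 3" by presburger
  \<comment> \<open>Here \<open>8 * n\<close> plus the sum of the four coefficients is exactly
    \<open>4 * ?M\<close>, so the all-odd representations of \<open>4 * ?M\<close> are those counted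
    by \<open>t_rep\<close>.\<close>
  then have "2 * ?N (4 * ?M) = 3 * t_rep a (3 * a) (16 * k + 4) (16 * m + 4) n + 6 * ?N ?M"
    using card_representations_four_mult[of "int a" "int k" "int m" "int ?M"] assms(1,2)
    unfolding N_rep_def t_rep_eq_card_odd by (simp add: algebra_simps)
  moreover have "4 * ?M = 8 * n + 16 * k + 16 * m + 4 * a + 8" by simp
  ultimately have "2 * ?N (8 * n + 16 * k + 16 * m + 4 * a + 8)
      = 3 * t_rep a (3 * a) (16 * k + 4) (16 * m + 4) n + 6 * ?N ?M"
    by metis
  then have "2 * real (?N (8 * n + 16 * k + 16 * m + 4 * a + 8))
      = 3 * real (t_rep a (3 * a) (16 * k + 4) (16 * m + 4) n) + 6 * real (?N ?M)"
    by linarith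
  then show ?thesis by linarith
qed

end
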